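(* For every $t\in\mathbb{C}\setminus\{0\}$, every $\mu\in\mathbb{R}$ and every integer $n\ge 0$, $$\left.\frac{\partial^{n}K_{\nu}(t)}{\partial\nu^{n}}\right|_{\nu=\mu}+(-1)^{n+1}\left.\frac{\partial^{n}K_{\nu}(t)}{\partial\nu^{n}}\right|_{\nu=-\mu}=0.$$
   Context: $I_\nu(t)=\sum_{k=0}^{\infty}\frac{1}{k!\,\Gamma(k+\nu+1)}\left(\frac{t}{2}\right)^{2k+\nu}$ is the modified Bessel function of the first kind (principal branch, $-\pi<\arg t\le\pi$; $1/\Gamma$ is zero at the poles of $\Gamma$), and $K_\nu(t)=\frac{\pi}{2}\,\frac{I_{-\nu}(t)-I_\nu(t)}{\sin\pi\nu}$ (for integer $\nu$, the limit in $\nu$) is the modified Bessel function of the second kind. A zeroth derivative is the function itself. *)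

theory Defs
  imports "HOL-Complex_Analysis.Complex_Analysis"
begin

text \<open>Modified Bessel functions of complex order \<open>\<nu>\<close> and argument \<open>t \<noteq> 0\<close>.
  The complex \<open>powr\<close> is the principal branch, cut along the negative real axis with
  \<open>-pi < arg t \<le> pi\<close>, and \<open>rGamma\<close> is the reciprocal of \<open>Gamma\<close>, extended by zero to its poles.\<close>

definition bessel_I :: "complex \<Rightarrow> complex \<Rightarrow> complex" where
  "bessel_I \<nu> t =
     (\<Sum>k. 1 / fact k * rGamma (of_nat k + \<nu> + 1) * (t / 2) powr (2 * of_nat k + \<nu>))"

definition bessel_K :: "complex \<Rightarrow> complex \<Rightarrow> complex" where
  "bessel_K \<nu> t =
     (let q = (\<lambda>s. of_real pi / 2 * ((bessel_I (- s) t - bessel_I s t) / sin (of_real pi * s)))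
      in if \<nu> \<in> \<int> then Lim (at \<nu>) q else q \<nu>)"

end

theory Submission
  imports Defs
begin

text \<open>The defining quotient of \<open>K\<close> is even in \<open>\<nu>\<close>, hence so is \<open>K\<close>, and differentiating
  \<open>K\<^sub>-\<^sub>\<nu> = K\<^sub>\<nu>\<close> \<open>n\<close> times gives the claim. Since \<open>deriv\<close> is unspecified where the function is not
  differentiable, evenness alone is not enough: \<open>K\<close> must be shown to be entire in \<open>\<nu>\<close>.
  The series for \<open>I\<close> is, up to the factor \<open>(t/2)\<^sup>\<nu>\<close>, locally uniformly convergent in \<open>\<nu>\<close>, and the
  singularities of the quotient at the integers are removable.\<close>

section \<open>Locally uniform convergence of the series\<close>

text \<open>By \<open>rGamma w = w * rGamma (w + 1)\<close>, each unit shift divides by a factor of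
  modulus at least 1.\<close>

lemma norm_rGamma_add_le:
  fixes z :: complex
  assumes "1 \<le> Re z"
  shows "norm (rGamma (z + of_nat m)) \<le> norm (rGamma z)"
proof (induction m)
  case 0
  then show ?case by simp
next
  case (Suc m)
  let ?w = "z + of_nat m"
  have "1 \<le> norm ?w"
    using assms complex_Re_le_cmod[of ?w] by simp
  then have "norm (rGamma (?w + 1)) \<le> norm ?w * norm (rGamma (?w + 1))"
    by (simp add: mult_le_cancel_right1)
  also have "\<dots> = norm (rGamma ?w)"
    by (metis norm_mult rGamma_plus1)
  finally show ?case
    using Suc.IH by (simp add: add_ac)
qed

text \<open>With \<open>(t / 2) powr \<nu>\<close> taken out, only integer powers of
  \<open>t / 2\<close> remain, and each term is entire in \<nu>.\<close>

definition bessel_I_term :: "complex \<Rightarrow> nat \<Rightarrow> complex \<Rightarrow> complex" where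
  "bessel_I_term t k \<nu> = rGamma (of_nat k + \<nu> + 1) * ((t / 2) ^ (2 * k) / fact k)"

text \<open>Majorant for the Weierstrass M-test. It is claimed only for large \<open>k\<close>: the
  reciprocal Gamma factor decreases in modulus under unit shifts once its argument has real part at
  least 1.\<close>

lemma bessel_I_term_bound:
  "\<exists>M. \<forall>\<^sub>F k in sequentially. \<forall>\<nu>\<in>cball 0 R.
     norm (bessel_I_term t k \<nu>) \<le> M * (norm (t / 2) ^ 2) ^ k / fact k"
proof -
  \<comment> \<open>This choice gives \<open>Re (of_nat N + \<nu> + 1) \<ge> 1\<close> on the whole
    disc; \<open>M\<close> then comes from compactness.\<close>
  obtain N :: nat where N: "R \<le> real N"
    using real_arch_simple by blast
  have "continuous_on (cball 0 R) (\<lambda>\<nu>::complex. rGamma (of_nat N + \<nu> + 1))"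
    by (intro holomorphic_on_imp_continuous_on holomorphic_intros)
  then have "bounded ((\<lambda>\<nu>::complex. rGamma (of_nat N + \<nu> + 1)) ` cball 0 R)"
    by (intro compact_imp_bounded compact_continuous_image) auto
  then obtain M where M: "\<And>\<nu>::complex. \<nu> \<in> cball 0 R \<Longrightarrow> norm (rGamma (of_nat N + \<nu> + 1)) \<le> M"
    unfolding bounded_iff by blast
  have "norm (bessel_I_term t k \<nu>) \<le> M * (norm (t / 2) ^ 2) ^ k / fact k"
    if k: "N \<le> k" and \<nu>: "\<nu> \<in> cball 0 R" for k \<nu>
  proof -
    obtain m where m: "k = N + m"
      using k le_iff_add by blast
    have "- Re \<nu> \<le> norm \<nu>"
      using abs_Re_le_cmod[of \<nu>] by linarith
    then have "norm (rGamma (of_nat N + \<nu> + 1 + of_nat m)) \<le> norm (rGamma (of_nat N + \<nu> + 1))"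
      using N \<nu> by (intro norm_rGamma_add_le) simp
    also have "\<dots> \<le> M"
      by (rule M[OF \<nu>])
    finally have "norm (rGamma (of_nat k + \<nu> + 1)) \<le> M"
      by (simp add: m add_ac)
    moreover have "norm ((t / 2) ^ (2 * k) / fact k) = (norm (t / 2) ^ 2) ^ k / fact k"
      by (simp only: norm_divide norm_power norm_fact power_mult)
    moreover have "0 \<le> (norm (t / 2) ^ 2) ^ k / fact k"
      by simp
    ultimately have "norm (bessel_I_term t k \<nu>) \<le> M * ((norm (t / 2) ^ 2) ^ k / fact k)"
      unfolding bessel_I_term_def norm_mult by (metis mult_right_mono)
    then show ?thesis by simp
  qed
  then show ?thesis
    unfolding eventually_sequentially by blast
qed

lemma uniform_limit_bessel_I_term:
  "uniform_limit (cball 0 R) (\<lambda>n \<nu>. \<Sum>k<n. bessel_I_term t k \<nu>)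
     (\<lambda>\<nu>. \<Sum>k. bessel_I_term t k \<nu>) sequentially"
proof -
  obtain M where "\<forall>\<^sub>F k in sequentially. \<forall>\<nu>\<in>cball 0 R.
      norm (bessel_I_term t k \<nu>) \<le> M * (norm (t / 2) ^ 2) ^ k / fact k"
    using bessel_I_term_bound by blast
  moreover have "summable (\<lambda>k. M * (norm (t / 2) ^ 2) ^ k / fact k)"
    using summable_mult[OF summable_exp[of "norm (t / 2) ^ 2"], of M]
    by (simp add: field_simps)
  ultimately show ?thesis
    by (rule Weierstrass_m_test_ev)
qed

lemma summable_bessel_I_term: "summable (\<lambda>k. bessel_I_term t k \<nu>)"
proof -
  have "(\<lambda>n. \<Sum>k<n. bessel_I_term t k \<nu>) \<longlonglongrightarrow> (\<Sum>k. bessel_I_term t k \<nu>)"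
    using tendsto_uniform_limitI[OF uniform_limit_bessel_I_term[where t = t and R = "norm \<nu>"], of \<nu>] by simp
  then show ?thesis
    using sums_def summable_def by blast
qed

section \<open>I as an entire function of the order\<close>

lemma bessel_I_eq:
  assumes "t \<noteq> 0"
  shows "bessel_I \<nu> t = (t / 2) powr \<nu> * (\<Sum>k. bessel_I_term t k \<nu>)"
proof -
  have "1 / fact k * rGamma (of_nat k + \<nu> + 1) * (t / 2) powr (2 * of_nat k + \<nu>)
      = (t / 2) powr \<nu> * bessel_I_term t k \<nu>" for k
  proof -
    have "(t / 2) powr (2 * of_nat k) = (t / 2) ^ (2 * k)"
      using powr_nat'[of "t / 2" "2 * k"] assms by simp
    then show ?thesis
      by (simp add: powr_add bessel_I_term_def)
  qed
  then have "bessel_I \<nu> t = (\<Sum>k. (t / 2) powr \<nu> * bessel_I_term t k \<nu>)"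
    unfolding bessel_I_def by simp
  also have "\<dots> = (t / 2) powr \<nu> * (\<Sum>k. bessel_I_term t k \<nu>)"
    by (rule suminf_mult[OF summable_bessel_I_term])
  finally show ?thesis .
qed

lemma holomorphic_bessel_I:
  assumes "t \<noteq> 0"
  shows "(\<lambda>\<nu>. bessel_I \<nu> t) holomorphic_on UNIV"
proof -
  have "(\<lambda>\<nu>. \<Sum>k. bessel_I_term t k \<nu>) holomorphic_on UNIV"
  proof (rule holomorphic_uniform_sequence)
    show "(\<lambda>\<nu>. \<Sum>k<n. bessel_I_term t k \<nu>) holomorphic_on UNIV" for n
      unfolding bessel_I_term_def by (intro holomorphic_intros)
    have "cball x 1 \<subseteq> cball 0 (norm x + 1)" for x :: complex
      by (simp add: cball_subset_cball_iff)
    then show "\<exists>d>0. cball x d \<subseteq> UNIV \<and>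
        uniform_limit (cball x d) (\<lambda>n \<nu>. \<Sum>k<n. bessel_I_term t k \<nu>)
          (\<lambda>\<nu>. \<Sum>k. bessel_I_term t k \<nu>) sequentially" for x
      using uniform_limit_on_subset[OF uniform_limit_bessel_I_term] zero_less_one by blast
  qed auto
  then show ?thesis
    unfolding bessel_I_eq[OF assms] using assms by (intro holomorphic_intros) auto
qed

text \<open>At order \<open>- n\<close> the first \<open>n\<close> terms vanish, since there 1/Gamma
  is taken at a pole of Gamma. Shifting the index by \<open>n\<close> turns the rest into the series
  at order \<open>n\<close>.\<close>

lemma bessel_I_minus_nat:
  assumes "t \<noteq> 0"
  shows "bessel_I (- of_nat n) t = bessel_I (of_nat n) t"
proof -
  have zero: "bessel_I_term t k (- of_nat n) = 0" if "k < n" for k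
  proof -
    have "of_nat k + - of_nat n + 1 = (- of_nat (n - Suc k) :: complex)"
      using that by (simp add: of_nat_diff)
    then show ?thesis
      by (simp add: bessel_I_term_def rGamma_eq_zero_iff)
  qed
  \<comment> \<open>Both coefficients equal \<open>1 / (fact m * fact (m + n))\<close>; only the
    powers of \<open>t / 2\<close> differ.\<close>
  have shift: "bessel_I_term t (m + n) (- of_nat n) = (t / 2) ^ (2 * n) * bessel_I_term t m (of_nat n)" for m
  proof -
    have "rGamma (of_nat j + 1 :: complex) = 1 / fact j" for j
      by (metis Gamma_fact add.commute inverse_eq_divide rGamma_inverse_Gamma)
    from this[of m] this[of "m + n"] show ?thesis
      by (simp add: bessel_I_term_def power_add distrib_left mult_ac)
  qed
  have "(\<Sum>k. bessel_I_term t k (- of_nat n)) = (\<Sum>m. bessel_I_term t (m + n) (- of_nat n))"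
    using suminf_split_initial_segment[OF summable_bessel_I_term, of t "- of_nat n" n] zero by simp
  also have "\<dots> = (t / 2) ^ (2 * n) * (\<Sum>m. bessel_I_term t m (of_nat n))"
    unfolding shift by (rule suminf_mult[OF summable_bessel_I_term])
  finally show ?thesis
    using assms by (simp add: bessel_I_eq powr_minus powr_nat' mult_2 mult_2_right power_add field_simps)
qed

lemma bessel_I_minus_int:
  assumes "t \<noteq> 0" "\<nu> \<in> \<int>"
  shows "bessel_I (- \<nu>) t = bessel_I \<nu> t"
proof -
  obtain i where i: "\<nu> = of_int i"
    using assms(2) by (auto elim: Ints_cases)
  then obtain n where "\<nu> = of_nat n \<or> \<nu> = - of_nat n"
    by (metis int_cases2 of_int_minus of_int_of_nat_eq)
  then show ?thesis
    using bessel_I_minus_nat[OF assms(1), of n] by auto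
qed

section \<open>The quotient defining K and its removable singularities\<close>

definition bessel_K_quot :: "complex \<Rightarrow> complex \<Rightarrow> complex" where
  "bessel_K_quot t s = of_real pi / 2 * ((bessel_I (- s) t - bessel_I s t) / sin (of_real pi * s))"

lemma bessel_K_eq:
  "bessel_K \<nu> t = (if \<nu> \<in> \<int> then Lim (at \<nu>) (bessel_K_quot t) else bessel_K_quot t \<nu>)"
  by (simp add: bessel_K_def bessel_K_quot_def[abs_def] Let_def)

text \<open>Numerator and denominator are both odd in the order.\<close>

lemma bessel_K_quot_minus: "bessel_K_quot t (- s) = bessel_K_quot t s"
  by (simp add: bessel_K_quot_def divide_simps right_diff_distrib)

lemma sin_pi_eq_0_iff: "sin (of_real pi * s) = 0 \<longleftrightarrow> s \<in> \<int>" for s :: complex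
proof -
  have "sin (of_real pi * s) = 0 \<longleftrightarrow> (\<exists>n::int. of_real pi * s = of_real (of_int n * pi))"
    by (simp add: sin_eq_0)
  also have "\<dots> \<longleftrightarrow> (\<exists>n::int. s = of_int n)"
    by simp
  finally show ?thesis
    by (auto elim: Ints_cases)
qed

lemma holomorphic_bessel_I_minus:
  assumes "t \<noteq> 0"
  shows "(\<lambda>\<nu>. bessel_I (- \<nu>) t) holomorphic_on UNIV"
  using holomorphic_on_compose_gen[OF _ holomorphic_bessel_I[OF assms], of uminus UNIV]
  by (simp add: o_def holomorphic_on_minus)

lemma holomorphic_bessel_K_quot:
  assumes "t \<noteq> 0"
  shows "bessel_K_quot t holomorphic_on - \<int>"
  unfolding bessel_K_quot_def[abs_def]
  using holomorphic_on_subset[OF holomorphic_bessel_I[OF assms]]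
    holomorphic_on_subset[OF holomorphic_bessel_I_minus[OF assms]]
  by (auto intro!: holomorphic_intros simp: sin_pi_eq_0_iff)

text \<open>The numerator vanishes at the integers because \<open>I\<^sub>-\<^sub>n = I\<^sub>n\<close>, and the sine has only simple
  zeros; so the limit defining \<open>K\<close> at an integer is a genuine one.\<close>

lemma tendsto_bessel_K:
  assumes "t \<noteq> 0" "\<nu> \<in> \<int>"
  shows "(bessel_K_quot t \<longlongrightarrow> bessel_K \<nu> t) (at \<nu>)"
proof -
  let ?F = "\<lambda>s. bessel_I (- s) t - bessel_I s t"
  let ?S = "\<lambda>s. sin (of_real pi * s)"
  have "?F holomorphic_on UNIV"
    by (intro holomorphic_intros holomorphic_bessel_I holomorphic_bessel_I_minus assms)
  then obtain D where D: "(?F has_field_derivative D) (at \<nu>)"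
    using holomorphic_on_imp_differentiable_at[of ?F UNIV \<nu>]
    by (auto simp: field_differentiable_def)
  have S: "(?S has_field_derivative cos (of_real pi * \<nu>) * of_real pi) (at \<nu>)"
    by (auto intro!: derivative_eq_intros)
  have S0: "?S \<nu> = 0"
    using assms(2) sin_pi_eq_0_iff by blast
  then have "cos (of_real pi * \<nu>) * of_real pi \<noteq> 0"
    using sin_cos_squared_add[of "of_real pi * \<nu>"] by auto
  moreover have "((\<lambda>s. (?F s - ?F \<nu>) / (s - \<nu>)) \<longlongrightarrow> D) (at \<nu>)"
    "((\<lambda>s. (?S s - ?S \<nu>) / (s - \<nu>)) \<longlongrightarrow> cos (of_real pi * \<nu>) * of_real pi) (at \<nu>)"
    using D S by (simp_all only: has_field_derivative_iff)
  ultimately have "((\<lambda>s. of_real pi / 2 * (((?F s - ?F \<nu>) / (s - \<nu>)) / ((?S s - ?S \<nu>) / (s - \<nu>))))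
      \<longlongrightarrow> of_real pi / 2 * (D / (cos (of_real pi * \<nu>) * of_real pi))) (at \<nu>)"
    by (intro tendsto_intros)
  \<comment> \<open>Both \<open>?F\<close> and \<open>?S\<close> vanish at \<nu>, and the common
    factor \<open>s - \<nu>\<close> cancels for \<open>s \<noteq> \<nu>\<close>.\<close>
  then have "(bessel_K_quot t \<longlongrightarrow> of_real pi / 2 * (D / (cos (of_real pi * \<nu>) * of_real pi))) (at \<nu>)"
    by (rule Lim_transform_eventually)
      (auto simp: bessel_K_quot_def S0 bessel_I_minus_int[OF assms] eventually_at_filter)
  then show ?thesis
    using assms(2) tendsto_Lim[OF trivial_limit_at] by (metis bessel_K_eq)
qed

text \<open>At an integer, evenness of the quotient passes to the limit: substitute
  \<open>- s\<close> for \<open>s\<close> and use uniqueness of limits.\<close>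

lemma bessel_K_minus:
  assumes "t \<noteq> 0"
  shows "bessel_K (- \<nu>) t = bessel_K \<nu> t"
proof (cases "\<nu> \<in> \<int>")
  case True
  have "filterlim (\<lambda>s. - s) (at (- \<nu>)) (at \<nu>)"
    by (auto intro!: filterlim_atI tendsto_intros simp: eventually_at_filter)
  then have "((\<lambda>s. bessel_K_quot t (- s)) \<longlongrightarrow> bessel_K (- \<nu>) t) (at \<nu>)"
    using tendsto_bessel_K[OF assms, of "- \<nu>"] True by (auto intro: filterlim_compose)
  then show ?thesis
    using tendsto_bessel_K[OF assms True] tendsto_unique[OF trivial_limit_at]
    by (auto simp: bessel_K_quot_minus)
next
  case False
  then show ?thesis
    by (simp add: bessel_K_eq bessel_K_quot_minus)
qed

text \<open>Off the integers K is the quotient. At an integer it is continuous by the limit above,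
  so the isolated singularity is removable.\<close>

lemma holomorphic_bessel_K:
  assumes "t \<noteq> 0"
  shows "(\<lambda>\<nu>. bessel_K \<nu> t) holomorphic_on UNIV"
proof -
  have off: "(\<lambda>\<nu>. bessel_K \<nu> t) holomorphic_on - \<int>"
    using holomorphic_bessel_K_quot[OF assms]
    by (rule holomorphic_transform) (simp add: bessel_K_eq)
  have open_off: "open (- \<int> :: complex set)"
    by (simp add: open_Compl)
  have "\<exists>e>0. (\<lambda>\<nu>. bessel_K \<nu> t) holomorphic_on ball z e" for z
  proof -
    \<comment> \<open>The integers are discrete, so some ball around \<open>z\<close> contains no
      integer except possibly \<open>z\<close> itself.\<close>
    have open_punctured: "open (- (\<int> - {z}))"
      by (intro open_Compl closed_subset_Ints) auto
    moreover have "z \<in> - (\<int> - {z})"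
      by simp
    ultimately obtain e where "e > 0" "ball z e \<subseteq> - (\<int> - {z})"
      by (rule openE)
    then have e: "e > 0" "ball z e - {z} \<subseteq> - \<int>"
      by auto
    have "\<forall>\<^sub>F s in at z. s \<in> - (\<int> - {z}) - {z}"
      using open_punctured by (intro eventually_at_in_open) auto
    then have nonint: "\<forall>\<^sub>F s in at z. s \<notin> \<int>"
      by eventually_elim auto
    have "isCont (\<lambda>\<nu>. bessel_K \<nu> t) s" if "s \<in> ball z e" for s
    proof (cases "s \<in> \<int>")
      case True
      then have "s = z" using e that by auto
      \<comment> \<open>The known limit is that of the quotient; it carries over to K because the
        two agree at all nearby points other than \<open>z\<close>.\<close>
      have "\<forall>\<^sub>F s in at z. bessel_K_quot t s = bessel_K s t"
        using nonint by eventually_elim (simp add: bessel_K_eq)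
      then show ?thesis
        unfolding isCont_def \<open>s = z\<close>
        using tendsto_bessel_K[OF assms, of z] True \<open>s = z\<close>
        by (auto intro: Lim_transform_eventually)
    next
      case False
      then show ?thesis
        using holomorphic_on_imp_continuous_on[OF off] continuous_on_eq_continuous_at[OF open_off]
        by blast
    qed
    then have "continuous_on (ball z e) (\<lambda>\<nu>. bessel_K \<nu> t)"
      by (simp add: continuous_at_imp_continuous_on)
    then have "(\<lambda>\<nu>. bessel_K \<nu> t) holomorphic_on ball z e"
      by (rule no_isolated_singularity[OF _ holomorphic_on_subset[OF off e(2)]]) auto
    then show ?thesis using e(1) by blast
  qed
  then have "(\<lambda>\<nu>. bessel_K \<nu> t) analytic_on UNIV"
    by (simp add: analytic_on_def)
  then show ?thesis
    by (rule analytic_imp_holomorphic)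
qed

theorem theorem3p12:
  fixes t :: complex and \<mu> :: real and n :: nat
  assumes "t \<noteq> 0"
  shows "(deriv ^^ n) (\<lambda>\<nu>. bessel_K \<nu> t) (of_real \<mu>)
       + (-1) ^ (n + 1) * (deriv ^^ n) (\<lambda>\<nu>. bessel_K \<nu> t) (of_real (- \<mu>)) = 0"
proof -
  \<comment> \<open>Reflection is written as multiplication by \<open>- 1\<close> to fit the chain
    rule for linear maps, each derivative giving a factor \<open>- 1\<close>. Evenness then removes
    the reflection on the left.\<close>
  have "(deriv ^^ n) (\<lambda>\<nu>. bessel_K (- 1 * \<nu>) t) (of_real \<mu>)
      = (- 1) ^ n * (deriv ^^ n) (\<lambda>\<nu>. bessel_K \<nu> t) (- 1 * of_real \<mu>)"
    by (rule higher_deriv_compose_linear[OF holomorphic_bessel_K[OF assms] open_UNIV open_UNIV]) auto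
  then show ?thesis
    by (simp add: bessel_K_minus[OF assms])
qed

end
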